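(* For every graph $G$ with at least one edge, Crapo's $\beta$ invariant of (the cycle matroid of) $G$ is $$\beta(G)=-(-1)^{\mathrm{rk}(G)} \sum_{N\in\mathscr{N}(G)} (-1)^{|E(N)|}.$$
   Context: Graphs are finite and undirected; multiple edges and self-loops are allowed. For $A\subseteq E(G)$, $\mathrm{rk}(A)$ is the rank in the cycle matroid of $G$, and $\mathrm{rk}(G)=\mathrm{rk}(E(G))$. Crapo's invariant is $\beta(G)=(-1)^{\mathrm{rk}(G)}\sum_{A\subseteq E(G)}(-1)^{|A|}\,\mathrm{rk}(A)$. A set $S\subseteq V(G)$ is a vertex cover if each edge of $G$ has at least one endpoint in $S$. A nucleus of $G$ is a connected non-empty subgraph $N=(V(N),E(N))$ (not necessarily induced; a single vertex without edges is allowed) such that $V(N)$ is a vertex cover of $G$. $\mathscr{N}(G)$ is the set of all nuclei of $G$. *)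

theory Defs
  imports Main
begin

text \<open>An edge carries its set of endpoints, a doubleton or, for a loop, a singleton.
  Parallel edges are distinct elements of \<open>edges G\<close> with equal endpoint sets.\<close>

record ('v, 'e) multigraph =
  verts :: "'v set"
  edges :: "'e set"
  ends :: "'e \<Rightarrow> 'v set"

definition finite_multigraph :: "('v, 'e) multigraph \<Rightarrow> bool" where
  "finite_multigraph G \<longleftrightarrow> finite (verts G) \<and> finite (edges G) \<and>
     (\<forall>e\<in>edges G. \<exists>u\<in>verts G. \<exists>v\<in>verts G. ends G e = {u, v})"

definition adjacency :: "('v, 'e) multigraph \<Rightarrow> 'v rel" where
  "adjacency G = {(u, v). \<exists>e\<in>edges G. ends G e = {u, v}}"

definition connected_multigraph :: "('v, 'e) multigraph \<Rightarrow> bool" where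
  "connected_multigraph G \<longleftrightarrow> (\<forall>u\<in>verts G. \<forall>v\<in>verts G. (u, v) \<in> (adjacency G)\<^sup>*)"

text \<open>A cycle visits the distinct vertices \<open>vs\<close> along the distinct edges \<open>es\<close>. Length 1
  gives the loops and length 2 the pairs of parallel non-loop edges.\<close>

definition is_cycle :: "('v, 'e) multigraph \<Rightarrow> 'v list \<Rightarrow> 'e list \<Rightarrow> bool" where
  "is_cycle G vs es \<longleftrightarrow> es \<noteq> [] \<and> length vs = length es \<and> distinct vs \<and> distinct es \<and>
     set es \<subseteq> edges G \<and>
     (\<forall>i<length es. ends G (es ! i) = {vs ! i, vs ! (Suc i mod length vs)})"

definition cycle_matroid_indep :: "('v, 'e) multigraph \<Rightarrow> 'e set \<Rightarrow> bool" where
  "cycle_matroid_indep G F \<longleftrightarrow> F \<subseteq> edges G \<and> \<not> (\<exists>vs es. is_cycle G vs es \<and> set es \<subseteq> F)"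

definition matroid_rank :: "('e set \<Rightarrow> bool) \<Rightarrow> 'e set \<Rightarrow> nat" where
  "matroid_rank indep A = Max (card ` {I. I \<subseteq> A \<and> indep I})"

definition rk :: "('v, 'e) multigraph \<Rightarrow> 'e set \<Rightarrow> nat" where
  "rk G A = matroid_rank (cycle_matroid_indep G) A"

definition crapo_beta :: "('v, 'e) multigraph \<Rightarrow> int" where
  "crapo_beta G = (-1) ^ rk G (edges G) * (\<Sum>A\<in>Pow (edges G). (-1) ^ card A * int (rk G A))"

definition vertex_cover :: "('v, 'e) multigraph \<Rightarrow> 'v set \<Rightarrow> bool" where
  "vertex_cover G S \<longleftrightarrow> S \<subseteq> verts G \<and> (\<forall>e\<in>edges G. ends G e \<inter> S \<noteq> {})"

text \<open>Requiring the total functions \<open>ends H\<close> and \<open>ends G\<close> to agree makes a subgraph \<open>H\<close>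
  determined by \<open>verts H\<close> and \<open>edges H\<close>, so that each subgraph is counted once.\<close>

definition subgraph :: "('v, 'e) multigraph \<Rightarrow> ('v, 'e) multigraph \<Rightarrow> bool" where
  "subgraph H G \<longleftrightarrow> verts H \<subseteq> verts G \<and> edges H \<subseteq> edges G \<and> ends H = ends G \<and>
     (\<forall>e\<in>edges H. ends H e \<subseteq> verts H)"

definition nuclei :: "('v, 'e) multigraph \<Rightarrow> ('v, 'e) multigraph set" where
  "nuclei G = {N. subgraph N G \<and> verts N \<noteq> {} \<and> connected_multigraph N \<and>
     vertex_cover G (verts N)}"

end

theory Submission
  imports Defs
begin

text \<open>Write \<open>c A\<close> for the number of connected components of the spanning subgraph with vertex
  set \<open>verts G\<close> and edge set \<open>A\<close>. Rank and component number are complementary,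
  \<open>rk G A = card (verts G) - c A\<close>. Since \<open>G\<close> has an edge, the signs \<open>(-1) ^ card A\<close> sum to \<open>0\<close>
  over all edge sets \<open>A\<close>, so the constant \<open>card (verts G)\<close> drops out of the sum defining
  Crapo's invariant, and what remains is the negative of the sum of \<open>(-1) ^ card A * c A\<close>.

  This last sum counts pairs of an edge set \<open>A\<close> and a component of it, with sign. Sort the pairs by
  the vertex set \<open>S\<close> of the component. The set \<open>S\<close> is a component of \<open>A\<close> exactly if \<open>A\<close> is the union
  of a set \<open>B\<close> of edges that connects \<open>S\<close> from inside and an arbitrary set \<open>D\<close> of edges that avoid
  \<open>S\<close> (\<open>component_iff\<close>). The signed sum over \<open>D\<close> vanishes unless no edge avoids \<open>S\<close>, that is,
  unless \<open>S\<close> is a vertex cover; then it is \<open>1\<close>. The surviving pairs \<open>(S, B)\<close> are precisely the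
  nuclei, each with sign \<open>(-1) ^ card B\<close> (\<open>signed_component_count\<close>).

  The rank formula rests on one fact about cycles: adding an edge to a forest closes a cycle
  exactly if the forest already joins the endpoints (\<open>indep_insert_iff\<close>). Hence each edge of a
  forest lowers the number of components by one, and a largest forest inside \<open>A\<close> has the same
  components as \<open>A\<close>.\<close>

section \<open>Components of spanning subgraphs\<close>

text \<open>The relation lives on the whole vertex type, where a vertex outside \<open>G\<close> is joined only to
  itself provided that all edges in \<open>A\<close> have their endpoints in \<open>G\<close>. This makes it an equivalence
  on \<open>UNIV\<close>; the restriction to vertices of \<open>G\<close> happens in the quotient below.\<close>

definition joined :: "('v, 'e) multigraph \<Rightarrow> 'e set \<Rightarrow> 'v rel" where
  "joined G A = (adjacency (G\<lparr>edges := A\<rparr>))\<^sup>*"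

definition components :: "('v, 'e) multigraph \<Rightarrow> 'e set \<Rightarrow> 'v set set" where
  "components G A = verts G // joined G A"

lemma adjacency_edges_update:
  "adjacency (G\<lparr>edges := A\<rparr>) = {(u, v). \<exists>e\<in>A. ends G e = {u, v}}"
  by (simp add: adjacency_def)

lemma joined_mono: "A \<subseteq> B \<Longrightarrow> joined G A \<subseteq> joined G B"
  unfolding joined_def adjacency_edges_update by (intro rtrancl_mono) auto

lemma equiv_joined: "equiv UNIV (joined G A)"
proof -
  have "sym (adjacency (G\<lparr>edges := A\<rparr>))"
    by (auto simp: sym_def adjacency_edges_update insert_commute)
  then show ?thesis
    unfolding joined_def by (intro equivI) (auto simp: refl_rtrancl trans_rtrancl sym_rtrancl)
qed

lemma joined_refl [simp]: "(u, u) \<in> joined G A"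
  by (simp add: joined_def)

lemma joined_sym: "(u, v) \<in> joined G A \<Longrightarrow> (v, u) \<in> joined G A"
  using equiv_joined by (metis equivE symD)

lemma joined_trans: "(u, v) \<in> joined G A \<Longrightarrow> (v, w) \<in> joined G A \<Longrightarrow> (u, w) \<in> joined G A"
  by (auto simp: joined_def)

lemma joined_edge: "e \<in> A \<Longrightarrow> ends G e = {u, v} \<Longrightarrow> (u, v) \<in> joined G A"
  unfolding joined_def adjacency_edges_update by auto

lemma joined_subsetI:
  assumes "\<And>e u v. e \<in> A \<Longrightarrow> ends G e = {u, v} \<Longrightarrow> (u, v) \<in> joined G B"
  shows "joined G A \<subseteq> joined G B"
proof -
  have "adjacency (G\<lparr>edges := A\<rparr>) \<subseteq> (adjacency (G\<lparr>edges := B\<rparr>))\<^sup>*"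
    using assms by (auto simp: joined_def adjacency_edges_update)
  from rtrancl_mono[OF this] show ?thesis by (simp add: joined_def)
qed

lemma components_eqI: "joined G A = joined G B \<Longrightarrow> components G A = components G B"
  by (simp add: components_def)

text \<open>A walk through the new edge \<open>e\<close> can be shortened so that it uses \<open>e\<close> only once, in one of the
  two directions.\<close>

lemma joined_insert:
  assumes e: "ends G e = {u, v}"
  shows "(x, y) \<in> joined G (insert e A) \<longleftrightarrow>
    (x, y) \<in> joined G A \<or>
    (x, u) \<in> joined G A \<and> (v, y) \<in> joined G A \<or>
    (x, v) \<in> joined G A \<and> (u, y) \<in> joined G A" (is "_ \<longleftrightarrow> ?R x y")
proof
  assume "(x, y) \<in> joined G (insert e A)"
  then have "(x, y) \<in> (adjacency (G\<lparr>edges := insert e A\<rparr>))\<^sup>*" by (simp add: joined_def)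
  then show "?R x y"
  proof (induction rule: rtrancl_induct)
    case base
    then show ?case by simp
  next
    case (step y z)
    from step.hyps(2) obtain f where f: "f \<in> insert e A" "ends G f = {y, z}"
      by (auto simp: adjacency_edges_update)
    show ?case
    proof (cases "f = e")
      case True
      then have "y = u \<and> z = v \<or> y = v \<and> z = u"
        using f e by (auto simp: doubleton_eq_iff)
      then show ?thesis using step.IH joined_refl joined_trans joined_sym by metis
    next
      case False
      then have "(y, z) \<in> joined G A" using joined_edge[of f A G y z] f by simp
      then show ?thesis using step.IH joined_trans by metis
    qed
  qed
next
  assume R: "?R x y"
  have uv: "(u, v) \<in> joined G (insert e A)" using e by (intro joined_edge) auto
  have "joined G A \<subseteq> joined G (insert e A)" by (intro joined_mono) auto
  then show "(x, y) \<in> joined G (insert e A)"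
    using R uv joined_sym[OF uv] joined_trans by (metis subsetD)
qed

text \<open>A new edge between different components merges these two and leaves all others as they
  were.\<close>

lemma card_components_insert:
  assumes fin: "finite (verts G)" and uv: "u \<in> verts G" "v \<in> verts G"
    and e: "ends G e = {u, v}" and sep: "(u, v) \<notin> joined G A"
  shows "card (components G A) = Suc (card (components G (insert e A)))"
proof -
  let ?c = "\<lambda>x. joined G A `` {x}" and ?d = "\<lambda>x. joined G (insert e A) `` {x}"
  have finC: "finite (components G A)"
    using fin by (simp add: components_def quotient_def)
  have same: "(x, y) \<in> joined G A \<longleftrightarrow> (z, y) \<in> joined G A" if "(x, z) \<in> joined G A" for x y z
    using joined_trans[OF that] joined_trans[OF joined_sym[OF that]] by blast
  have duv: "?d x = ?c u \<union> ?c v" if "(x, u) \<in> joined G A \<or> (x, v) \<in> joined G A" for x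
    using that
  proof
    assume "(x, u) \<in> joined G A"
    note xz = same[OF this]
    show ?thesis by (auto simp: joined_insert[OF e] xz)
  next
    assume "(x, v) \<in> joined G A"
    note xz = same[OF this]
    show ?thesis by (auto simp: joined_insert[OF e] xz)
  qed
  have other: "?d x = ?c x" if "(x, u) \<notin> joined G A" "(x, v) \<notin> joined G A" for x
    using that by (auto simp: joined_insert[OF e])
  have ceq: "?c x = ?c y \<longleftrightarrow> (x, y) \<in> joined G A" for x y
    using equiv_joined by (metis UNIV_I eq_equiv_class_iff)
  have im: "components G B = (\<lambda>x. joined G B `` {x}) ` verts G" for B
    by (auto simp: components_def quotient_def)
  let ?K = "components G A - {?c u, ?c v}"
  have "components G (insert e A) = insert (?c u \<union> ?c v) ?K"
  proof (intro equalityI subsetI)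
    fix X assume "X \<in> components G (insert e A)"
    then obtain x where x: "x \<in> verts G" "X = ?d x" by (auto simp: im)
    show "X \<in> insert (?c u \<union> ?c v) ?K"
    proof (cases "(x, u) \<in> joined G A \<or> (x, v) \<in> joined G A")
      case True
      then show ?thesis using duv x by simp
    next
      case False
      then show ?thesis using other x ceq by (auto simp: im)
    qed
  next
    fix X assume X: "X \<in> insert (?c u \<union> ?c v) ?K"
    show "X \<in> components G (insert e A)"
    proof (cases "X = ?c u \<union> ?c v")
      case True
      then have "X = ?d u" using duv[of u] by simp
      then show ?thesis using uv by (auto simp: im)
    next
      case False
      then obtain x where x: "x \<in> verts G" "X = ?c x" "X \<noteq> ?c u" "X \<noteq> ?c v"
        using X by (auto simp: im)
      then have "X = ?d x" using other ceq by metis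
      then show ?thesis using x by (auto simp: im)
    qed
  qed
  moreover have "?c u \<union> ?c v \<notin> ?K"
  proof
    assume "?c u \<union> ?c v \<in> ?K"
    then obtain x where x: "?c u \<union> ?c v = ?c x" by (auto simp: im)
    have "u \<in> ?c u \<union> ?c v" "v \<in> ?c u \<union> ?c v" by simp_all
    then have "(x, u) \<in> joined G A" "(x, v) \<in> joined G A" unfolding x by simp_all
    then show False using sep joined_trans joined_sym by metis
  qed
  moreover have "card ?K = card (components G A) - 2"
  proof -
    have "?c u \<noteq> ?c v" using ceq sep by simp
    then show ?thesis using uv finC by (subst card_Diff_subset) (auto simp: im)
  qed
  moreover have "card (components G A) \<ge> 2"
  proof -
    have "card {?c u, ?c v} = 2" using ceq sep by simp
    moreover have "{?c u, ?c v} \<subseteq> components G A" using uv by (auto simp: im)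
    ultimately show ?thesis using finC card_mono by metis
  qed
  ultimately show ?thesis using finC by simp
qed

section \<open>Cycles and the rank formula\<close>

text \<open>A walk becomes a path by cutting it back to the first visit whenever it returns to a
  vertex.\<close>

lemma joined_imp_path:
  assumes "(u, v) \<in> joined G A"
  shows "\<exists>vs es. length vs = Suc (length es) \<and> vs ! 0 = u \<and> vs ! length es = v \<and>
    distinct vs \<and> set es \<subseteq> A \<and> (\<forall>i<length es. ends G (es ! i) = {vs ! i, vs ! Suc i})"
  using assms unfolding joined_def
proof (induction rule: rtrancl_induct)
  case base
  show ?case by (intro exI[of _ "[u]"] exI[of _ "[]"]) simp
next
  case (step y z)
  from step.IH obtain vs es where p: "length vs = Suc (length es)" "vs ! 0 = u"
    "vs ! length es = y" "distinct vs" "set es \<subseteq> A"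
    "\<forall>i<length es. ends G (es ! i) = {vs ! i, vs ! Suc i}" by (elim exE conjE) (rule that)
  from step.hyps(2) obtain f where f: "f \<in> A" "ends G f = {y, z}"
    by (auto simp: adjacency_edges_update)
  show ?case
  proof (cases "z \<in> set vs")
    case True
    then obtain k where k: "k < length vs" "vs ! k = z" by (auto simp: in_set_conv_nth)
    have "set (take k es) \<subseteq> A" using p(5) set_take_subset by (rule subset_trans[rotated])
    moreover have "k \<le> length es" using k p(1) by simp
    ultimately show ?thesis using p k
      by (intro exI[of _ "take (Suc k) vs"] exI[of _ "take k es"]) (simp add: min_absorb2)
  next
    case False
    then show ?thesis using p f
      by (intro exI[of _ "vs @ [z]"] exI[of _ "es @ [f]"]) (auto simp: nth_append less_Suc_eq)
  qed
qed

text \<open>A path from \<open>u\<close> to \<open>v\<close> in \<open>I\<close> is closed up by \<open>e\<close>. If \<open>u = v\<close>, the path has no edges and the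
  cycle is the loop \<open>e\<close>.\<close>

lemma cycle_if_joined:
  assumes uv: "(u, v) \<in> joined G I" and e: "ends G e = {u, v}" "e \<notin> I"
    and E: "insert e I \<subseteq> edges G"
  shows "\<not> cycle_matroid_indep G (insert e I)"
proof -
  from joined_imp_path[OF uv] obtain vs es where p: "length vs = Suc (length es)" "vs ! 0 = u"
    "vs ! length es = v" "distinct vs" "set es \<subseteq> I"
    "\<forall>i<length es. ends G (es ! i) = {vs ! i, vs ! Suc i}" by (elim exE conjE) (rule that)
  \<comment> \<open>Equal edges would have equal endpoint sets, although the path visits distinct vertices.\<close>
  have neq: "es ! i \<noteq> es ! j" if "i < j" "j < length es" for i j
  proof
    assume "es ! i = es ! j"
    then have "{vs ! i, vs ! Suc i} = {vs ! j, vs ! Suc j}" using p(6) that by (metis order.strict_trans)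
    then have "vs ! i = vs ! j \<or> vs ! i = vs ! Suc j" unfolding doubleton_eq_iff by blast
    then show False using that p(1) nth_eq_iff_index_eq[OF p(4)] by simp
  qed
  have "distinct es"
    unfolding distinct_conv_nth
  proof (intro allI impI)
    fix i j assume "i < length es" "j < length es" "i \<noteq> j"
    then show "es ! i \<noteq> es ! j" using neq[of i j] neq[of j i] by (cases "i < j") auto
  qed
  moreover have "ends G ((es @ [e]) ! i) = {vs ! i, vs ! (Suc i mod length vs)}"
    if "i < length (es @ [e])" for i
    using that p(1,2,3,6) e(1) by (cases "i = length es") (auto simp: nth_append insert_commute)
  ultimately have "is_cycle G vs (es @ [e])"
    using p(1,4,5) e(2) E by (auto simp: is_cycle_def)
  moreover have "set (es @ [e]) \<subseteq> insert e I" using p by auto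
  ultimately show ?thesis unfolding cycle_matroid_indep_def by blast
qed

text \<open>Conversely, a cycle in \<open>insert e I\<close> has to use \<open>e\<close>, and its other edges form a walk in \<open>I\<close>
  between the endpoints of \<open>e\<close>.\<close>

lemma joined_if_cycle:
  assumes ind: "cycle_matroid_indep G I" and dep: "\<not> cycle_matroid_indep G (insert e I)"
    and E: "e \<in> edges G" and e: "ends G e = {u, v}"
  shows "(u, v) \<in> joined G I"
proof -
  obtain vs es where c: "is_cycle G vs es" "set es \<subseteq> insert e I"
    using ind dep E by (auto simp: cycle_matroid_indep_def)
  let ?n = "length es"
  have "\<not> set es \<subseteq> I" using c(1) ind by (simp add: cycle_matroid_indep_def)
  then have "e \<in> set es" using c(2) by blast
  then obtain i where i: "i < ?n" "es ! i = e" by (auto simp: in_set_conv_nth)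
  have n: "length vs = ?n" "distinct es"
    and en: "\<And>j. j < ?n \<Longrightarrow> ends G (es ! j) = {vs ! j, vs ! (Suc j mod ?n)}"
    using c(1) by (auto simp: is_cycle_def)
  \<comment> \<open>Start just after \<open>e\<close> and go round the cycle for \<open>k\<close> steps; the bound on \<open>k\<close> stops before \<open>e\<close>.\<close>
  have walk: "(vs ! (Suc i mod ?n), vs ! ((Suc i + k) mod ?n)) \<in> joined G I" if "k < ?n" for k
    using that
  proof (induction k)
    case 0
    then show ?case by simp
  next
    case (Suc k)
    let ?j = "(Suc i + k) mod ?n"
    have j: "?j < ?n" using i by (intro mod_less_divisor) linarith
    have "?j \<noteq> i"
    proof
      assume "?j = i"
      moreover have "?j = Suc i + k \<or> ?j + ?n = Suc i + k"
        using i(1) Suc.prems by (cases "Suc i + k < ?n") (auto simp: le_mod_geq)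
      ultimately show False using Suc.prems i(1) by linarith
    qed
    then have "es ! ?j \<noteq> e" using n(2) i j by (metis nth_eq_iff_index_eq)
    then have "es ! ?j \<in> I" using c(2) j nth_mem by blast
    from joined_edge[OF this en[OF j]]
    have "(vs ! ?j, vs ! (Suc ?j mod ?n)) \<in> joined G I" .
    moreover have "Suc ?j mod ?n = (Suc i + Suc k) mod ?n" by (simp add: mod_Suc_eq)
    ultimately show ?case using Suc joined_trans by (metis Suc_lessD)
  qed
  have "(Suc i + (?n - 1)) mod ?n = i"
  proof -
    have "Suc i + (?n - 1) = i + ?n" using i(1) by simp
    then show ?thesis using i(1) by simp
  qed
  then have "(vs ! (Suc i mod ?n), vs ! i) \<in> joined G I"
    using walk[of "?n - 1"] i by simp
  moreover have "{u, v} = {vs ! i, vs ! (Suc i mod ?n)}" using en[OF i(1)] i e by simp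
  ultimately show ?thesis using joined_sym by (metis doubleton_eq_iff)
qed

lemma indep_insert_iff:
  assumes "cycle_matroid_indep G I" "e \<in> edges G" "e \<notin> I" "ends G e = {u, v}"
  shows "cycle_matroid_indep G (insert e I) \<longleftrightarrow> (u, v) \<notin> joined G I"
proof -
  have "insert e I \<subseteq> edges G" using assms by (auto simp: cycle_matroid_indep_def)
  then show ?thesis using assms cycle_if_joined joined_if_cycle by metis
qed

lemma indep_subset: "cycle_matroid_indep G I \<Longrightarrow> J \<subseteq> I \<Longrightarrow> cycle_matroid_indep G J"
  unfolding cycle_matroid_indep_def by blast

lemma card_forest:
  assumes G: "finite_multigraph G" and I: "cycle_matroid_indep G I"
  shows "card I + card (components G I) = card (verts G)"
proof -
  have "finite I" using G I finite_subset by (auto simp: finite_multigraph_def cycle_matroid_indep_def)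
  then show ?thesis using I
  proof (induction I rule: finite_induct)
    case empty
    have "joined G {} = Id" by (simp add: joined_def adjacency_edges_update)
    then have "components G {} = (\<lambda>x. {x}) ` verts G" by (auto simp: components_def quotient_def)
    then show ?case by (simp add: card_image)
  next
    case (insert e I)
    have I: "cycle_matroid_indep G I" using insert.prems indep_subset by blast
    have "e \<in> edges G" using insert.prems by (auto simp: cycle_matroid_indep_def)
    moreover from this obtain u v where uv: "u \<in> verts G" "v \<in> verts G" "ends G e = {u, v}"
      using G by (auto simp: finite_multigraph_def)
    ultimately have "(u, v) \<notin> joined G I"
      using insert.prems insert.hyps I indep_insert_iff by metis
    then have "card (components G I) = Suc (card (components G (insert e I)))"
      using uv G card_components_insert by (metis finite_multigraph_def)
    then show ?case using insert.IH[OF I] insert.hyps by simp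
  qed
qed

text \<open>An edge of \<open>A\<close> outside a largest forest \<open>I\<close> inside \<open>A\<close> would close a cycle, so \<open>I\<close> joins its
  endpoints. Hence \<open>I\<close> and \<open>A\<close> have the same components, and the forest formula for \<open>I\<close>
  applies.\<close>

lemma rank_eq_verts_minus_components:
  assumes G: "finite_multigraph G" and A: "A \<subseteq> edges G"
  shows "int (rk G A) = int (card (verts G)) - int (card (components G A))"
proof -
  let ?\<I> = "{I. I \<subseteq> A \<and> cycle_matroid_indep G I}"
  have finA: "finite A" using G A finite_subset by (auto simp: finite_multigraph_def)
  have fin: "finite (card ` ?\<I>)" using finA by simp
  have "{} \<in> ?\<I>" by (auto simp: cycle_matroid_indep_def is_cycle_def)
  then have "Max (card ` ?\<I>) \<in> card ` ?\<I>" using fin by (intro Max_in) auto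
  then obtain I where I: "I \<subseteq> A" "cycle_matroid_indep G I" "rk G A = card I"
    by (auto simp: rk_def matroid_rank_def)
  have "joined G A \<subseteq> joined G I"
  proof (rule joined_subsetI)
    fix e u v assume e: "e \<in> A" "ends G e = {u, v}"
    show "(u, v) \<in> joined G I"
    proof (cases "e \<in> I")
      case True
      then show ?thesis using joined_edge[of e I G u v] e by simp
    next
      case False
      have "\<not> cycle_matroid_indep G (insert e I)"
      proof
        assume "cycle_matroid_indep G (insert e I)"
        then have "card (insert e I) \<le> rk G A"
          unfolding rk_def matroid_rank_def using fin e I by (intro Max_ge) auto
        then show False using I False finA finite_subset by fastforce
      qed
      then show ?thesis using indep_insert_iff I e False A by (metis subsetD)
    qed
  qed
  then have "components G A = components G I"
    using joined_mono[OF I(1)] by (intro components_eqI) blast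
  then show ?thesis using card_forest[OF G I(2)] I(3) by simp
qed

section \<open>Signed counting of components\<close>

text \<open>This is the expansion of the product of the differences \<open>1 - 1\<close> over \<open>E\<close>.\<close>

lemma alternating_sum_Pow:
  assumes "finite E"
  shows "(\<Sum>A\<in>Pow E. (-1 :: int) ^ card A) = (if E = {} then 1 else 0)"
  using prod_diff_conv_sum[OF assms, of "\<lambda>_. 1 :: int" "\<lambda>_. 1"] assms
  by (simp add: power_0_left)

text \<open>For nonempty \<open>S\<close>, these are the edge sets of the connected subgraphs of \<open>G\<close> with vertex set
  \<open>S\<close>.\<close>

definition spanning_connected :: "('v, 'e) multigraph \<Rightarrow> 'v set \<Rightarrow> 'e set set" where
  "spanning_connected G S =
    {B. B \<subseteq> {e \<in> edges G. ends G e \<subseteq> S} \<and> S \<times> S \<subseteq> joined G B}"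

text \<open>No edge of \<open>A\<close> leaves a component \<open>S\<close>, so the edges of \<open>A\<close> lie inside \<open>S\<close> or avoid it, and a
  walk that starts in \<open>S\<close> uses only edges of the first kind.\<close>

lemma component_iff:
  assumes G: "finite_multigraph G" and S: "S \<subseteq> verts G" "S \<noteq> {}" and A: "A \<subseteq> edges G"
  shows "S \<in> components G A \<longleftrightarrow>
    (\<exists>B\<in>spanning_connected G S. \<exists>D\<subseteq>{e \<in> edges G. ends G e \<inter> S = {}}. A = B \<union> D)"
proof
  assume "S \<in> components G A"
  then obtain x where x: "x \<in> verts G" "S = joined G A `` {x}"
    by (auto simp: components_def quotient_def)
  let ?B = "{e \<in> A. ends G e \<subseteq> S}" and ?D = "{e \<in> A. ends G e \<inter> S = {}}"
  have "A \<subseteq> ?B \<union> ?D"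
  proof
    fix e assume e: "e \<in> A"
    then obtain u v where uv: "ends G e = {u, v}"
      using G A unfolding finite_multigraph_def by blast
    have "(u, v) \<in> joined G A" using e uv by (rule joined_edge)
    then have "(x, u) \<in> joined G A \<longleftrightarrow> (x, v) \<in> joined G A"
      using joined_trans joined_sym by metis
    then show "e \<in> ?B \<union> ?D" using e uv x(2) by auto
  qed
  then have AU: "A = ?B \<union> ?D" by blast
  have from_x: "(x, y) \<in> joined G ?B" if "y \<in> S" for y
  proof -
    have "(x, y) \<in> (adjacency (G\<lparr>edges := A\<rparr>))\<^sup>*" using that x(2) by (simp add: joined_def)
    then show ?thesis
    proof (induction rule: rtrancl_induct)
      case base
      show ?case by simp
    next
      case (step y z)
      from step.hyps(2) obtain e where e: "e \<in> A" "ends G e = {y, z}"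
        by (auto simp: adjacency_edges_update)
      have "(x, y) \<in> joined G A" using step.hyps(1) by (simp add: joined_def)
      moreover from this have "(x, z) \<in> joined G A"
        using joined_trans joined_edge[OF e] by metis
      ultimately have "e \<in> ?B" using e x(2) by simp
      then show ?case using joined_trans[OF step.IH joined_edge[OF _ e(2)]] by blast
    qed
  qed
  have "S \<times> S \<subseteq> joined G ?B"
  proof (rule subrelI)
    fix y z assume "(y, z) \<in> S \<times> S"
    then have "(x, y) \<in> joined G ?B" "(x, z) \<in> joined G ?B" using from_x by blast+
    then show "(y, z) \<in> joined G ?B" by (rule joined_trans[OF joined_sym])
  qed
  moreover have "?B \<subseteq> {e \<in> edges G. ends G e \<subseteq> S}" using A by auto
  ultimately have "?B \<in> spanning_connected G S" unfolding spanning_connected_def by blast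
  moreover have "?D \<subseteq> {e \<in> edges G. ends G e \<inter> S = {}}" using A by auto
  ultimately show "\<exists>B\<in>spanning_connected G S. \<exists>D\<subseteq>{e \<in> edges G. ends G e \<inter> S = {}}. A = B \<union> D"
    using AU by blast
next
  assume "\<exists>B\<in>spanning_connected G S. \<exists>D\<subseteq>{e \<in> edges G. ends G e \<inter> S = {}}. A = B \<union> D"
  then obtain B D where B: "B \<subseteq> {e \<in> edges G. ends G e \<subseteq> S}" "S \<times> S \<subseteq> joined G B"
    and D: "D \<subseteq> {e \<in> edges G. ends G e \<inter> S = {}}" and AB: "A = B \<union> D"
    unfolding spanning_connected_def by blast
  obtain x where x: "x \<in> S" using S by blast
  have "joined G A `` {x} \<subseteq> S"
  proof clarsimp
    fix y assume "(x, y) \<in> joined G A"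
    then have "(x, y) \<in> (adjacency (G\<lparr>edges := A\<rparr>))\<^sup>*" by (simp add: joined_def)
    then show "y \<in> S"
    proof (induction rule: rtrancl_induct)
      case base
      show ?case by (rule x)
    next
      case (step y z)
      from step.hyps(2) obtain e where e: "e \<in> A" "ends G e = {y, z}"
        by (auto simp: adjacency_edges_update)
      then have "e \<notin> D" using D step.IH by blast
      then have "ends G e \<subseteq> S" using e(1) AB B(1) by blast
      then show ?case using e(2) by simp
    qed
  qed
  moreover have "joined G B \<subseteq> joined G A" using AB by (intro joined_mono) blast
  then have "S \<subseteq> joined G A `` {x}" using B(2) x by blast
  ultimately have "S = joined G A `` {x}" by (rule equalityI[rotated])
  then show "S \<in> components G A"
    using x S unfolding components_def by (metis quotientI subsetD)
qed

text \<open>The decomposition \<open>A = B \<union> D\<close> is unique and its two parts are chosen independently, so the sum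
  is a product. Its second factor is the alternating sum over all sets of edges that avoid \<open>S\<close>.\<close>

lemma signed_sum_with_component:
  assumes G: "finite_multigraph G" and S: "S \<subseteq> verts G" "S \<noteq> {}"
  shows "(\<Sum>A | A \<in> Pow (edges G) \<and> S \<in> components G A. (-1 :: int) ^ card A) =
    (if vertex_cover G S then \<Sum>B\<in>spanning_connected G S. (-1) ^ card B else 0)"
proof -
  let ?K = "spanning_connected G S" and ?F = "{e \<in> edges G. ends G e \<inter> S = {}}"
  have finE: "finite (edges G)" using G by (simp add: finite_multigraph_def)
  have inside: "ends G e \<noteq> {}" "e \<in> edges G" "ends G e \<subseteq> S" if "B \<in> ?K" "e \<in> B" for B e
  proof -
    show "e \<in> edges G" "ends G e \<subseteq> S" using that by (auto simp: spanning_connected_def)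
    then show "ends G e \<noteq> {}" using G by (auto simp: finite_multigraph_def)
  qed
  have disj: "B \<inter> D = {}" if "B \<in> ?K" "D \<in> Pow ?F" for B D
    using inside[OF that(1)] that(2) by blast
  have fin: "finite B" "finite D" if "B \<in> ?K" "D \<in> Pow ?F" for B D
    using that finE by (auto simp: spanning_connected_def intro: finite_subset)
  have "inj_on (\<lambda>(B, D). B \<union> D) (?K \<times> Pow ?F)"
  proof (rule inj_onI, clarify)
    fix B D B' D' assume h: "B \<in> ?K" "D \<subseteq> ?F" "B' \<in> ?K" "D' \<subseteq> ?F" "B \<union> D = B' \<union> D'"
    have "B \<inter> D' = {}" "B' \<inter> D = {}" "B \<inter> D = {}" "B' \<inter> D' = {}" using h disj by blast+
    then show "B = B' \<and> D = D'" using h(5) by blast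
  qed
  moreover have "(\<lambda>(B, D). B \<union> D) ` (?K \<times> Pow ?F) =
      {A. A \<in> Pow (edges G) \<and> S \<in> components G A}" (is "?L = ?R")
  proof (intro equalityI subsetI)
    fix A assume "A \<in> ?L"
    then obtain B D where BD: "B \<in> ?K" "D \<subseteq> ?F" "A = B \<union> D" by auto
    then have "A \<subseteq> edges G" using inside(2) by blast
    then show "A \<in> ?R" using component_iff[OF G S] BD by blast
  next
    fix A assume "A \<in> ?R"
    then obtain B D where "B \<in> ?K" "D \<subseteq> ?F" "A = B \<union> D" using component_iff[OF G S, of A] by blast
    then show "A \<in> ?L" by auto
  qed
  ultimately have "bij_betw (\<lambda>(B, D). B \<union> D) (?K \<times> Pow ?F)
      {A. A \<in> Pow (edges G) \<and> S \<in> components G A}"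
    by (simp add: bij_betw_def)
  then have "(\<Sum>A | A \<in> Pow (edges G) \<and> S \<in> components G A. (-1 :: int) ^ card A) =
      (\<Sum>(B, D)\<in>?K \<times> Pow ?F. (-1) ^ card (B \<union> D))"
    by (subst sum.reindex_bij_betw[symmetric]) (auto simp: case_prod_unfold)
  also have "\<dots> = (\<Sum>(B, D)\<in>?K \<times> Pow ?F. (-1) ^ card B * (-1) ^ card D)"
    using disj fin by (intro sum.cong) (auto simp: card_Un_disjoint power_add)
  also have "\<dots> = (\<Sum>B\<in>?K. (-1) ^ card B) * (\<Sum>D\<in>Pow ?F. (-1) ^ card D)"
    by (simp add: sum_product sum.cartesian_product)
  also have "(\<Sum>D\<in>Pow ?F. (-1 :: int) ^ card D) = (if ?F = {} then 1 else 0)"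
    using finE by (intro alternating_sum_Pow) simp
  also have "?F = {} \<longleftrightarrow> vertex_cover G S" using S by (auto simp: vertex_cover_def)
  finally show ?thesis by simp
qed

lemma nuclei_as_pairs:
  "bij_betw (\<lambda>(S, B). \<lparr>verts = S, edges = B, ends = ends G\<rparr>)
    (SIGMA S:{S. S \<noteq> {} \<and> vertex_cover G S}. spanning_connected G S) (nuclei G)"
proof -
  let ?f = "\<lambda>(S, B). \<lparr>verts = S, edges = B, ends = ends G\<rparr>"
  have conn: "connected_multigraph \<lparr>verts = S, edges = B, ends = ends G\<rparr> \<longleftrightarrow>
      S \<times> S \<subseteq> joined G B" for S B
  proof -
    have "adjacency \<lparr>verts = S, edges = B, ends = ends G\<rparr> = adjacency (G\<lparr>edges := B\<rparr>)"
      by (simp add: adjacency_def)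
    then show ?thesis
      unfolding connected_multigraph_def joined_def by (simp add: subset_iff) blast
  qed
  have "inj_on ?f X" for X by (auto simp: inj_on_def)
  moreover have "?f ` (SIGMA S:{S. S \<noteq> {} \<and> vertex_cover G S}. spanning_connected G S) = nuclei G"
  proof (intro equalityI subsetI)
    fix N assume "N \<in> ?f ` (SIGMA S:{S. S \<noteq> {} \<and> vertex_cover G S}. spanning_connected G S)"
    then show "N \<in> nuclei G"
      using conn by (fastforce simp: nuclei_def subgraph_def spanning_connected_def vertex_cover_def)
  next
    fix N assume N: "N \<in> nuclei G"
    then have eq: "N = ?f (verts N, edges N)" by (simp add: nuclei_def subgraph_def)
    then have "connected_multigraph (?f (verts N, edges N))" using N by (simp add: nuclei_def)
    then have "(verts N, edges N) \<in>
        (SIGMA S:{S. S \<noteq> {} \<and> vertex_cover G S}. spanning_connected G S)"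
      using N conn by (fastforce simp: nuclei_def subgraph_def spanning_connected_def)
    then show "N \<in> ?f ` (SIGMA S:{S. S \<noteq> {} \<and> vertex_cover G S}. spanning_connected G S)"
      using eq by (rule rev_image_eqI)
  qed
  ultimately show ?thesis by (simp add: bij_betw_def)
qed

text \<open>Count the pairs of an edge set and one of its components in the other order, by
  component.\<close>

lemma signed_component_count:
  assumes G: "finite_multigraph G"
  shows "(\<Sum>A\<in>Pow (edges G). (-1) ^ card A * int (card (components G A))) =
    (\<Sum>N\<in>nuclei G. (-1) ^ card (edges N))"
proof -
  let ?V = "Pow (verts G) - {{}}"
  have fin: "finite (verts G)" "finite (edges G)"
    using G by (simp_all add: finite_multigraph_def)
  have ends: "ends G e \<subseteq> verts G" if "e \<in> edges G" for e
  proof -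
    from that obtain u v where "u \<in> verts G" "v \<in> verts G" "ends G e = {u, v}"
      using G unfolding finite_multigraph_def by blast
    then show ?thesis by simp
  qed
  have comp: "components G A \<subseteq> ?V" if "A \<subseteq> edges G" for A
  proof
    fix S assume "S \<in> components G A"
    then obtain x where x: "x \<in> verts G" "S = joined G A `` {x}"
      by (auto simp: components_def quotient_def)
    have "y \<in> verts G" if "(x, y) \<in> joined G A" for y
      using that unfolding joined_def
    proof (cases rule: rtranclE)
      case base
      then show ?thesis using x by simp
    next
      case (step z)
      from step(2) obtain e where "e \<in> A" "ends G e = {z, y}"
        by (auto simp: adjacency_edges_update)
      then show ?thesis using ends[of e] \<open>A \<subseteq> edges G\<close> by blast
    qed
    moreover have "x \<in> S" using x by simp
    ultimately show "S \<in> ?V" using x(2) by blast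
  qed
  have "(\<Sum>A\<in>Pow (edges G). (-1) ^ card A * int (card (components G A))) =
      (\<Sum>A\<in>Pow (edges G). \<Sum>S | S \<in> ?V \<and> S \<in> components G A. (-1) ^ card A)"
  proof (rule sum.cong[OF refl])
    fix A assume "A \<in> Pow (edges G)"
    then have "{S. S \<in> ?V \<and> S \<in> components G A} = components G A" using comp by blast
    then show "(-1) ^ card A * int (card (components G A)) =
        (\<Sum>S | S \<in> ?V \<and> S \<in> components G A. (-1) ^ card A)" by simp
  qed
  also have "\<dots> = (\<Sum>S\<in>?V. \<Sum>A | A \<in> Pow (edges G) \<and> S \<in> components G A. (-1) ^ card A)"
    using fin by (intro sum.swap_restrict) simp_all
  also have "\<dots> = (\<Sum>S\<in>?V. if vertex_cover G S then \<Sum>B\<in>spanning_connected G S. (-1) ^ card B else 0)"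
    using signed_sum_with_component[OF G] by (intro sum.cong) auto
  also have "\<dots> = (\<Sum>S | S \<in> ?V \<and> vertex_cover G S. \<Sum>B\<in>spanning_connected G S. (-1) ^ card B)"
    using fin by (intro sum.inter_filter[symmetric]) simp
  also have "{S. S \<in> ?V \<and> vertex_cover G S} = {S. S \<noteq> {} \<and> vertex_cover G S}" (is "_ = ?C")
    by (auto simp: vertex_cover_def)
  also have "(\<Sum>S\<in>?C. \<Sum>B\<in>spanning_connected G S. (-1) ^ card B) =
      (\<Sum>(S, B)\<in>(SIGMA S:?C. spanning_connected G S). (-1) ^ card B)"
  proof (rule sum.Sigma)
    have "?C \<subseteq> Pow (verts G)" by (auto simp: vertex_cover_def)
    then show "finite ?C" using fin finite_subset by blast
    have "spanning_connected G S \<subseteq> Pow (edges G)" for S by (auto simp: spanning_connected_def)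
    then show "\<forall>S\<in>?C. finite (spanning_connected G S)" using fin by (meson finite_Pow_iff finite_subset)
  qed
  also have "\<dots> = (\<Sum>N\<in>nuclei G. (-1) ^ card (edges N))"
    using sum.reindex_bij_betw[OF nuclei_as_pairs, of "\<lambda>N. (-1) ^ card (edges N)" G]
    by (simp add: case_prod_unfold)
  finally show ?thesis .
qed

theorem corollary2p4:
  fixes G :: "('v, 'e) multigraph"
  assumes "finite_multigraph G"
    and "edges G \<noteq> {}"
  shows "crapo_beta G = - ((-1) ^ rk G (edges G)) * (\<Sum>N\<in>nuclei G. (-1) ^ card (edges N))"
proof -
  have fin: "finite (edges G)" using assms(1) by (simp add: finite_multigraph_def)
  have "(\<Sum>A\<in>Pow (edges G). (-1) ^ card A * int (rk G A)) =
      (\<Sum>A\<in>Pow (edges G). int (card (verts G)) * (-1) ^ card A -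
        (-1) ^ card A * int (card (components G A)))"
    using rank_eq_verts_minus_components[OF assms(1)]
    by (intro sum.cong) (simp_all add: right_diff_distrib mult.commute)
  also have "\<dots> = int (card (verts G)) * (\<Sum>A\<in>Pow (edges G). (-1) ^ card A) -
      (\<Sum>A\<in>Pow (edges G). (-1) ^ card A * int (card (components G A)))"
    by (simp add: sum_subtractf sum_distrib_left)
  also have "\<dots> = - (\<Sum>N\<in>nuclei G. (-1) ^ card (edges N))"
    using alternating_sum_Pow[OF fin] assms(2) signed_component_count[OF assms(1)] by simp
  finally show ?thesis by (simp add: crapo_beta_def)
qed

end
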